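(* Let $G$ be an infinite abelian group of finite exponent $\ell$. Then the following two statements hold for all integers $h,k\ge 1$. (1) $X_G(h,k)\le \ell^{2k}(h+1)-\ell^k+h$. (2) If $\ell$ is a prime power, then $X_G(h)\le \ell h+\ell^2-\ell$.
   Context: For subsets $A,B$ of an abelian semigroup, $A\sim B$ means that the symmetric difference of $A$ and $B$ is finite. $hA$ denotes the $h$-fold Minkowski sum $A+\cdots+A$ ($h\ge 1$ copies). A subset $A\subset G$ is an additive basis of $G$ if $hA\sim G$ for some integer $h\ge 1$; the smallest such $h$ is its order $\mathrm{ord}^*_G(A)$. A subset $F$ of an additive basis $A$ is regular if $A\setminus F$ is still an additive basis of $G$. For integers $h,k\ge1$, $X_G(h,k)$ is the maximum of $\mathrm{ord}_G^*(A\setminus F)$ over all $A\subset G$ with $hA\sim G$ and all regular subsets $F\subset A$ with $|F|=k$ (a priori a supremum, possibly infinite), and $X_G(h)=X_G(h,1)$. *)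

theory Defs
  imports
    "HOL-Algebra.Algebra"
    "HOL-Number_Theory.Prime_Powers"
    "HOL-Library.Extended_Nat"
begin

(* Abelian groups are written multiplicatively, following HOL-Algebra: the Minkowski sum A + B is
   set_mult, A <#> B, and the multiple n x is the power x [^] n. *)

definition almost_eq :: "'a set \<Rightarrow> 'a set \<Rightarrow> bool" (infix "\<sim>\<^sub>f" 50)
  where "A \<sim>\<^sub>f B \<longleftrightarrow> finite (sym_diff A B)"

(* The 0-fold sumset is the trivial subgroup; only h \<ge> 1 is used below. *)
primrec sumset :: "('a, 'b) monoid_scheme \<Rightarrow> nat \<Rightarrow> 'a set \<Rightarrow> 'a set"
  where
    "sumset G 0 A = {\<one>\<^bsub>G\<^esub>}"
  | "sumset G (Suc h) A = A <#>\<^bsub>G\<^esub> sumset G h A"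

definition additive_basis :: "('a, 'b) monoid_scheme \<Rightarrow> 'a set \<Rightarrow> bool"
  where "additive_basis G A \<longleftrightarrow>
    A \<subseteq> carrier G \<and> (\<exists>h\<ge>1. sumset G h A \<sim>\<^sub>f carrier G)"

(* Minimum over a set of natural numbers; the value is \<infinity> exactly when no such h exists. *)
definition basis_ord :: "('a, 'b) monoid_scheme \<Rightarrow> 'a set \<Rightarrow> enat"
  where "basis_ord G A = (INF h \<in> {h. h \<ge> 1 \<and> sumset G h A \<sim>\<^sub>f carrier G}. enat h)"

definition regular_subset :: "('a, 'b) monoid_scheme \<Rightarrow> 'a set \<Rightarrow> 'a set \<Rightarrow> bool"
  where "regular_subset G A F \<longleftrightarrow> F \<subseteq> A \<and> additive_basis G (A - F)"

(* The supremum is taken in enat, so it may be \<infinity>, and it is 0 if there is no admissible pair.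
   For k \<ge> 1, card F = k forces F to be finite. *)
definition max_basis_ord :: "('a, 'b) monoid_scheme \<Rightarrow> nat \<Rightarrow> nat \<Rightarrow> enat"
  where "max_basis_ord G h k =
    (SUP (A, F) \<in> {(A, F). A \<subseteq> carrier G \<and> sumset G h A \<sim>\<^sub>f carrier G \<and>
        regular_subset G A F \<and> card F = k}. basis_ord G (A - F))"

definition has_exponent :: "('a, 'b) monoid_scheme \<Rightarrow> nat \<Rightarrow> bool"
  where "has_exponent G l \<longleftrightarrow>
    l \<ge> 1 \<and> (\<forall>x \<in> carrier G. x [^]\<^bsub>G\<^esub> l = \<one>\<^bsub>G\<^esub>) \<and>
    (\<forall>m\<ge>1. (\<forall>x \<in> carrier G. x [^]\<^bsub>G\<^esub> m = \<one>\<^bsub>G\<^esub>) \<longrightarrow> l \<le> m)"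

end

(* G is written additively in this comment. Let B = A - F. All but finitely many x in G are sums of
   few elements of B up to an "error": after translating so that 0 is in B, an element of a finite
   subgroup H containing F, with |H| \<le> l^|F|; after translating so that F = {0}, the length i \<le> h of a
   representation of x as a sum of i elements of B. If these errors were unique modulo a proper
   subgroup K of H (respectively modulo the prime p dividing l), adding an element of B would change
   them by 0 (respectively by 1). Every element of G is a sum of elements of B, so walking along
   such a sum from a starting point chosen to avoid the exceptional set gives a contradiction. Hence
   (1) H is generated by its elements that are sums of l h + 1 elements of B, so the sums of
   |H| (l h + 1) elements of B cover H;
   (2) some z is a sum of a as well as of b elements of B with a, b \<le> h + 1 and a \<noteq> b modulo p;
   then (l - 1) z has representations of lengths in all residue classes modulo l, and lengths can
   be increased by l because l b = 0 for b in B. *)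

theory Submission
  imports Defs "HOL-Number_Theory.Cong"
begin

lemma sumset_mono: "A \<subseteq> B \<Longrightarrow> sumset G n A \<subseteq> sumset G n B"
  by (induction n) (auto intro: mono_set_mult[THEN subsetD])

lemma almost_eq_carrier_iff: "U \<subseteq> C \<Longrightarrow> U \<sim>\<^sub>f C \<longleftrightarrow> finite (C - U)"
  by (simp add: almost_eq_def Diff_eq_empty_iff[THEN iffD2])

section \<open>Minkowski sums\<close>

context comm_group
begin

lemma set_mult_memI: "x \<in> U \<Longrightarrow> y \<in> V \<Longrightarrow> x \<otimes> y \<in> U <#> V"
  by (auto simp: set_mult_def)

lemma inv_mult_cancel: "x \<in> carrier G \<Longrightarrow> y \<in> carrier G \<Longrightarrow> inv x \<otimes> (x \<otimes> y) = y"
  by (simp add: m_assoc[symmetric])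

lemma sumset_subset: "A \<subseteq> carrier G \<Longrightarrow> sumset G n A \<subseteq> carrier G"
  by (induction n) (auto intro: set_mult_closed[THEN subsetD])

lemma sumset_add:
  assumes "A \<subseteq> carrier G"
  shows "sumset G (m + n) A = sumset G m A <#> sumset G n A"
proof (induction m)
  case 0
  have "sumset G n A \<subseteq> carrier G" by (rule sumset_subset[OF assms])
  then show ?case by (force simp: set_mult_def)
next
  case (Suc m)
  then show ?case
    using assms by (simp add: set_mult_assoc sumset_subset)
qed

lemma sumset_add_memI:
  assumes "A \<subseteq> carrier G" "x \<in> sumset G m A" "y \<in> sumset G n A"
  shows "x \<otimes> y \<in> sumset G (m + n) A"
  using assms by (auto simp: sumset_add intro: set_mult_memI)

lemma sumset_1: "A \<subseteq> carrier G \<Longrightarrow> sumset G 1 A = A"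
  by (force simp: set_mult_def)

lemma sumset_mult:
  assumes "A \<subseteq> carrier G"
  shows "sumset G (m * n) A = sumset G m (sumset G n A)"
  by (induction m) (simp_all add: sumset_add[OF assms])

lemma sumset_pow:
  assumes "A \<subseteq> carrier G" "x \<in> sumset G n A"
  shows "x [^] j \<in> sumset G (j * n) A"
proof (induction j)
  case (Suc j)
  have "x [^] j \<otimes> x \<in> sumset G (j * n + n) A"
    using Suc assms by (intro sumset_add_memI)
  then show ?case by (simp add: add.commute)
qed simp

lemma sumset_le:
  assumes "A \<subseteq> carrier G" "\<one> \<in> A" "m \<le> n"
  shows "sumset G m A \<subseteq> sumset G n A"
proof -
  have one: "\<one> \<in> sumset G (n - m) A"
    using sumset_pow[of A \<one> 1 "n - m"] assms by (simp add: sumset_1 del: One_nat_def)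
  have "x \<otimes> \<one> \<in> sumset G (m + (n - m)) A" if "x \<in> sumset G m A" for x
    using that one assms by (intro sumset_add_memI)
  then show ?thesis
    using assms sumset_subset[OF assms(1), of m] by (auto simp: subset_iff)
qed

section \<open>Translates of sets and sumsets\<close>

lemma l_coset_eq_image: "c <# U = (\<otimes>) c ` U"
  by (auto simp: l_coset_def)

lemma sumset_l_coset:
  assumes "A \<subseteq> carrier G" "c \<in> carrier G"
  shows "sumset G n (c <# A) = c [^] n <# sumset G n A"
proof (induction n)
  case 0
  then show ?case by (simp add: l_coset_def)
next
  case (Suc n)
  let ?S = "sumset G n A"
  have eq: "(c \<otimes> a) \<otimes> (c [^] n \<otimes> s) = c [^] Suc n \<otimes> (a \<otimes> s)" if "a \<in> A" "s \<in> ?S" for a s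
  proof -
    have "a \<in> carrier G" "s \<in> carrier G" "c [^] n \<in> carrier G"
      using that assms sumset_subset[OF assms(1)] by auto
    then show ?thesis using assms by (simp add: m_ac)
  qed
  have "sumset G (Suc n) (c <# A) = (\<Union>a\<in>A. \<Union>s\<in>?S. {(c \<otimes> a) \<otimes> (c [^] n \<otimes> s)})"
    unfolding sumset.simps Suc by (simp add: set_mult_def l_coset_def)
  also have "\<dots> = (\<Union>a\<in>A. \<Union>s\<in>?S. {c [^] Suc n \<otimes> (a \<otimes> s)})"
    by (simp add: eq del: nat_pow_Suc)
  finally show ?case
    by (simp add: set_mult_def l_coset_def del: nat_pow_Suc)
qed

lemma almost_eq_l_coset:
  assumes "U \<subseteq> carrier G" "c \<in> carrier G" "U \<sim>\<^sub>f carrier G"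
  shows "c <# U \<sim>\<^sub>f carrier G"
proof -
  have fin: "finite (carrier G - U)"
    using assms by (simp add: almost_eq_carrier_iff)
  have "carrier G - (c <# U) \<subseteq> (\<otimes>) c ` (carrier G - U)"
  proof
    fix y assume y: "y \<in> carrier G - (c <# U)"
    then have eq: "y = c \<otimes> (inv c \<otimes> y)"
      using assms by (simp add: m_assoc[symmetric])
    then have "inv c \<otimes> y \<notin> U"
      using y by (auto simp: l_coset_eq_image)
    then show "y \<in> (\<otimes>) c ` (carrier G - U)"
      using y eq assms by (intro image_eqI[of _ _ "inv c \<otimes> y"]) auto
  qed
  then have "finite (carrier G - (c <# U))"
    using fin finite_subset by blast
  moreover have "c <# U \<subseteq> carrier G"
    using assms by (auto simp: l_coset_eq_image)
  ultimately show ?thesis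
    by (simp add: almost_eq_carrier_iff)
qed

text \<open>Translating \<open>A\<close> by \<open>c\<close> translates its \<open>n\<close>-fold
  sumset by \<open>c [^] n\<close>, and a translation maps cofinite sets to cofinite sets. This
  permits moving any chosen element to the identity.\<close>

lemma sumset_l_coset_almost_eq_iff:
  assumes "A \<subseteq> carrier G" "c \<in> carrier G"
  shows "sumset G n (c <# A) \<sim>\<^sub>f carrier G \<longleftrightarrow> sumset G n A \<sim>\<^sub>f carrier G"
proof
  assume "sumset G n A \<sim>\<^sub>f carrier G"
  then show "sumset G n (c <# A) \<sim>\<^sub>f carrier G"
    using assms by (simp add: sumset_l_coset almost_eq_l_coset sumset_subset)
next
  let ?S = "sumset G n A"
  assume "sumset G n (c <# A) \<sim>\<^sub>f carrier G"
  moreover have sub: "?S \<subseteq> carrier G" by (rule sumset_subset) fact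
  ultimately have "inv (c [^] n) <# (c [^] n <# ?S) \<sim>\<^sub>f carrier G"
    using assms by (intro almost_eq_l_coset[OF l_coset_subset_G]) (simp_all add: sumset_l_coset)
  then show "?S \<sim>\<^sub>f carrier G"
    using assms sub by (simp only: lcos_m_assoc nat_pow_closed inv_closed l_inv lcos_mult_one)
qed

text \<open>Given \<open>g\<close>, only finitely many \<open>x\<close> have \<open>x\<close> or
  \<open>g \<otimes> inv x\<close> outside the cofinite \<open>M\<close>-fold sumset. Any other
  \<open>x\<close> splits \<open>g\<close> into two factors of length \<open>M\<close>.\<close>

lemma sumset_double_eq_carrier:
  assumes "infinite (carrier G)" "B \<subseteq> carrier G" "sumset G M B \<sim>\<^sub>f carrier G"
  shows "sumset G (M + M) B = carrier G"
proof
  let ?S = "sumset G M B"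
  have sub: "?S \<subseteq> carrier G" by (rule sumset_subset) fact
  then have fin: "finite (carrier G - ?S)"
    using assms by (simp add: almost_eq_carrier_iff)
  show "carrier G \<subseteq> sumset G (M + M) B"
  proof
    fix g assume g: "g \<in> carrier G"
    let ?E = "(carrier G - ?S) \<union> (\<lambda>e. g \<otimes> inv e) ` (carrier G - ?S)"
    have "infinite (carrier G - ?E)"
      using assms(1) fin by (intro Diff_infinite_finite) auto
    then obtain x where "x \<in> carrier G - ?E"
      using infinite_imp_nonempty by blast
    then have x: "x \<in> carrier G" "x \<notin> ?E" by blast+
    have "g \<otimes> inv (g \<otimes> inv x) = x"
      using g x m_lcomm[of g x "inv g"] by (simp add: inv_mult_group)
    then have "g \<otimes> inv x \<notin> carrier G - ?S"
      using x(2) by (metis (no_types, lifting) UnCI imageI)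
    then have "g \<otimes> inv x \<in> ?S"
      using x g by simp
    moreover have "x \<in> ?S" using x by auto
    ultimately have "g \<otimes> inv x \<otimes> x \<in> sumset G (M + M) B"
      using assms(2) by (intro sumset_add_memI)
    then show "g \<in> sumset G (M + M) B"
      using g x by (simp add: m_assoc)
  qed
qed (use assms sumset_subset in blast)

section \<open>Walks whose steps are single elements of \<open>B\<close>\<close>

lemma sumset_path:
  assumes "B \<subseteq> carrier G" "g \<in> sumset G n B"
  obtains c :: "nat \<Rightarrow> 'a" where "c 0 = \<one>" "c n = g" "\<And>i. c i \<in> carrier G"
    "\<And>i. i < n \<Longrightarrow> \<exists>b\<in>B. c (Suc i) = b \<otimes> c i"
proof -
  have "\<exists>c. c 0 = \<one> \<and> c n = g \<and> (\<forall>i. c i \<in> carrier G) \<and>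
      (\<forall>i<n. \<exists>b\<in>B. c (Suc i) = b \<otimes> c i)"
    using assms(2)
  proof (induction n arbitrary: g)
    case 0
    then show ?case by (intro exI[of _ "\<lambda>_. \<one>"]) simp
  next
    case (Suc n)
    then obtain b g' where b: "b \<in> B" "g' \<in> sumset G n B" "g = b \<otimes> g'"
      by (auto simp: set_mult_def)
    with Suc.IH obtain c where c: "c 0 = \<one>" "c n = g'" "\<forall>i. c i \<in> carrier G"
      "\<forall>i<n. \<exists>b\<in>B. c (Suc i) = b \<otimes> c i"
      by blast
    have "g \<in> carrier G" using b c assms(1) by auto
    with b c show ?case
      \<comment> \<open>The walk lists the partial products of a factorisation of \<open>g\<close>.
        Its values beyond the last index are arbitrary group elements, so membership in the carrier
        needs no index bound.\<close>
      by (intro exI[of _ "c(Suc n := g)"]) (auto simp: less_Suc_eq)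
  qed
  then show ?thesis using that by blast
qed

text \<open>Translating a walk by \<open>y\<close> keeps its steps. The \<open>n + 1\<close>
  conditions that the translated vertices avoid \<open>E\<close> exclude only finitely many starting
  points \<open>y\<close>.\<close>

lemma sumset_path_avoiding:
  assumes "infinite (carrier G)" "finite E" "B \<subseteq> carrier G" "g \<in> sumset G n B"
  obtains c :: "nat \<Rightarrow> 'a" where "c n = c 0 \<otimes> g" "\<And>i. i \<le> n \<Longrightarrow> c i \<in> carrier G - E"
    "\<And>i. i < n \<Longrightarrow> \<exists>b\<in>B. c (Suc i) = b \<otimes> c i"
proof -
  obtain c where c: "c 0 = \<one>" "c n = g" "\<And>i. c i \<in> carrier G"
    "\<And>i. i < n \<Longrightarrow> \<exists>b\<in>B. c (Suc i) = b \<otimes> c i"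
    using sumset_path[OF assms(3,4)] by metis
  have "infinite (carrier G - (\<Union>i\<le>n. (\<lambda>e. e \<otimes> inv (c i)) ` E))"
    using assms(1,2) by (intro Diff_infinite_finite) auto
  then obtain y where "y \<in> carrier G - (\<Union>i\<le>n. (\<lambda>e. e \<otimes> inv (c i)) ` E)"
    using infinite_imp_nonempty by blast
  then have y: "y \<in> carrier G" "\<And>i. i \<le> n \<Longrightarrow> y \<notin> (\<lambda>e. e \<otimes> inv (c i)) ` E"
    by blast+
  have "y \<otimes> c i \<notin> E" if "i \<le> n" for i
  proof
    assume "y \<otimes> c i \<in> E"
    moreover have "y = (y \<otimes> c i) \<otimes> inv (c i)" using y c by (simp add: m_assoc)
    ultimately show False using y(2)[OF that] by blast
  qed
  moreover have "\<exists>b\<in>B. y \<otimes> c (Suc i) = b \<otimes> (y \<otimes> c i)" if i: "i < n" for i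
  proof -
    obtain b where "b \<in> B" "c (Suc i) = b \<otimes> c i" using c(4)[OF i] by blast
    then show ?thesis using y c(3)[of i] assms(3) by (intro bexI[of _ b]) (auto simp: m_lcomm)
  qed
  ultimately show ?thesis
    using c y by (intro that[of "\<lambda>i. y \<otimes> c i"]) auto
qed

section \<open>Removing a finite set\<close>

text \<open>In exponent dividing \<open>l\<close>, \<open>inv x = x [^] (l - 1)\<close>, so closure
  under products gives closure under inverses.\<close>

lemma subgroup_if_exponent:
  assumes "S \<subseteq> carrier G" "\<one> \<in> S" "\<And>x y. x \<in> S \<Longrightarrow> y \<in> S \<Longrightarrow> x \<otimes> y \<in> S"
    and l: "l \<ge> 1" "\<And>x. x \<in> carrier G \<Longrightarrow> x [^] (l::nat) = \<one>"
  shows "subgroup S G"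
proof
  fix x assume x: "x \<in> S"
  then have xc: "x \<in> carrier G" using assms by blast
  have "x [^] (j::nat) \<in> S" for j
    by (induction j) (use assms x in auto)
  moreover have "x [^] (l - 1) \<otimes> x = \<one>"
    using l xc by (metis le_add_diff_inverse2 nat_pow_Suc add.commute plus_1_eq_Suc)
  then have "inv x = x [^] (l - 1)"
    using xc by (intro inv_equality) auto
  ultimately show "inv x \<in> S" by simp
qed (use assms in auto)

text \<open>Inversion as the power \<open>l - 1\<close> makes quotients into products of elements of
  \<open>A\<close>; its cost \<open>(l - 1) * n\<close> is the source of the length
  \<open>l * h + 1\<close> below.\<close>

lemma inv_in_sumset:
  assumes "A \<subseteq> carrier G" "x \<in> sumset G n A" "l \<ge> 1" "x [^] (l::nat) = \<one>"
  shows "inv x \<in> sumset G ((l - 1) * n) A"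
proof -
  have xc: "x \<in> carrier G" using assms sumset_subset by blast
  have "x [^] (l - 1) \<otimes> x = \<one>"
    using assms xc by (metis le_add_diff_inverse2 nat_pow_Suc add.commute plus_1_eq_Suc)
  then have "inv x = x [^] (l - 1)"
    using xc by (intro inv_equality) auto
  then show ?thesis using sumset_pow[OF assms(1,2)] by simp
qed

text \<open>Adjoining one element \<open>a\<close> to a finite subgroup multiplies its size by at
  most \<open>l\<close>, the number of powers of \<open>a\<close> to consider.\<close>

lemma exists_finite_subgroup:
  assumes "finite F" "F \<subseteq> carrier G"
    and l: "l \<ge> 1" "\<And>x. x \<in> carrier G \<Longrightarrow> x [^] (l::nat) = \<one>"
  shows "\<exists>H. subgroup H G \<and> F \<subseteq> H \<and> finite H \<and> card H \<le> l ^ card F"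
  using assms(1,2)
proof (induction F)
  case empty
  then show ?case by (intro exI[of _ "{\<one>}"]) (auto intro: triv_subgroup)
next
  case (insert a F)
  then obtain H where H: "subgroup H G" "F \<subseteq> H" "finite H" "card H \<le> l ^ card F"
    by auto
  interpret H: subgroup H G by (rule H)
  have a: "a \<in> carrier G" using insert by auto
  let ?H = "(\<lambda>(i, x). a [^] i \<otimes> x) ` ({..<l} \<times> H)"
  \<comment> \<open>Reducing exponents modulo \<open>l\<close> admits all powers of
    \<open>a\<close>, which makes closure under products immediate.\<close>
  have mem: "a [^] i \<otimes> x \<in> ?H" if "x \<in> H" for i :: nat and x
  proof -
    have "a [^] i = a [^] (l * (i div l) + i mod l)" by simp
    also have "\<dots> = a [^] (i mod l)"
      using a l by (simp only: nat_pow_mult[symmetric] nat_pow_pow[symmetric]) simp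
    finally have "a [^] i = a [^] (i mod l)" .
    then show ?thesis using that l by (intro image_eqI[of _ _ "(i mod l, x)"]) auto
  qed
  have "subgroup ?H G"
  proof (rule subgroup_if_exponent[OF _ _ _ l])
    show "?H \<subseteq> carrier G" using a by auto
    show "\<one> \<in> ?H" using mem[of \<one> 0] by simp
    fix u v assume "u \<in> ?H" "v \<in> ?H"
    then obtain i j :: nat and x y
      where *: "u = a [^] i \<otimes> x" "v = a [^] j \<otimes> y" "x \<in> H" "y \<in> H"
      by auto
    have "u \<otimes> v = a [^] (i + j) \<otimes> (x \<otimes> y)"
      using * a by (simp add: nat_pow_mult[symmetric] m_ac)
    then show "u \<otimes> v \<in> ?H" using mem * by simp
  qed auto
  moreover have "a \<in> ?H" using mem[of \<one> 1] a by simp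
  moreover have "F \<subseteq> ?H"
  proof
    fix x assume "x \<in> F"
    then show "x \<in> ?H" using mem[of x 0] H(2) by auto
  qed
  moreover have "card ?H \<le> l ^ card (insert a F)"
  proof -
    have "card ?H \<le> card ({..<l} \<times> H)"
      using H by (intro card_image_le) auto
    also have "\<dots> \<le> l * l ^ card F"
      using H by (simp add: card_cartesian_product)
    finally show ?thesis using insert by simp
  qed
  ultimately show ?case using H(3) by (intro exI[of _ ?H]) auto
qed

text \<open>Along a walk from \<open>c 0\<close> to \<open>c 0 \<otimes> t\<close> inside the
  cofinite set \<open>H <#> sumset G h B\<close>, the \<open>H\<close>-component is constant modulo
  \<open>K\<close>. Comparing the decompositions at the two ends then puts \<open>t\<close> in
  \<open>K\<close>.\<close>

lemma subgroup_le_if_contains_short_sums: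
  assumes "infinite (carrier G)"
    and l: "l \<ge> 1" "\<And>x. x \<in> carrier G \<Longrightarrow> x [^] (l::nat) = \<one>"
    and B: "B \<subseteq> carrier G" "\<one> \<in> B" "sumset G M B \<sim>\<^sub>f carrier G"
    and H: "subgroup H G" "H <#> sumset G h B \<sim>\<^sub>f carrier G"
    and K: "subgroup K G" "H \<inter> sumset G (l * h + 1) B \<subseteq> K"
  shows "H \<subseteq> K"
proof
  fix t assume t: "t \<in> H"
  interpret H: subgroup H G by (rule H)
  interpret K: subgroup K G by (rule K)
  have S_sub: "sumset G h B \<subseteq> carrier G" using B by (intro sumset_subset)
  have "H <#> sumset G h B \<subseteq> carrier G"
    using S_sub H.subset by (rule set_mult_closed[rotated])
  then have "finite (carrier G - (H <#> sumset G h B))"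
    using H by (simp add: almost_eq_carrier_iff)
  moreover have "t \<in> sumset G (M + M) B"
    using t sumset_double_eq_carrier[OF assms(1) B(1,3)] by simp
  ultimately obtain c where c_end: "c (M + M) = c 0 \<otimes> t"
    and c_mem: "\<And>i. i \<le> M + M \<Longrightarrow> c i \<in> carrier G - (carrier G - (H <#> sumset G h B))"
    and c_step: "\<And>i. i < M + M \<Longrightarrow> \<exists>b\<in>B. c (Suc i) = b \<otimes> c i"
    using sumset_path_avoiding[OF assms(1) _ B(1)] by metis
  have c_decomp: "\<exists>s\<in>H. \<exists>\<beta>\<in>sumset G h B. c i = s \<otimes> \<beta>" if "i \<le> M + M" for i
    using c_mem[OF that] by (auto simp: set_mult_def)
  obtain s0 \<beta>0 where s0: "s0 \<in> H" "\<beta>0 \<in> sumset G h B" "c 0 = s0 \<otimes> \<beta>0"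
    using c_decomp[of 0] by auto
  have quot: "x \<otimes> inv y \<in> sumset G (m + (l - 1) * h) B"
    if "x \<in> sumset G m B" "y \<in> sumset G h B" for x y m
    using that B l S_sub by (intro sumset_add_memI inv_in_sumset) auto
  have "\<exists>s\<in>H. \<exists>\<beta>\<in>sumset G h B. c i = s \<otimes> \<beta> \<and> s \<otimes> inv s0 \<in> K" if "i \<le> M + M" for i
    using that
  proof (induction i)
    case 0
    have "s0 \<otimes> inv s0 \<in> K" using s0 by simp
    then show ?case using s0 by blast
  next
    case (Suc i)
    then obtain s \<beta> where s: "s \<in> H" "\<beta> \<in> sumset G h B" "c i = s \<otimes> \<beta>" "s \<otimes> inv s0 \<in> K"
      by auto
    obtain s' \<beta>' where s': "s' \<in> H" "\<beta>' \<in> sumset G h B" "c (Suc i) = s' \<otimes> \<beta>'"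
      using c_decomp[OF Suc.prems] by blast
    obtain b where b: "b \<in> B" "c (Suc i) = b \<otimes> c i"
      using c_step[of i] Suc.prems by auto
    have carr: "s \<in> carrier G" "s' \<in> carrier G" "s0 \<in> carrier G" "\<beta> \<in> carrier G" "\<beta>' \<in> carrier G" "b \<in> carrier G"
      using s s' s0 b B S_sub by auto
    have eq: "s' \<otimes> \<beta>' = b \<otimes> (s \<otimes> \<beta>)" using s s' b by simp
    \<comment> \<open>The change of the \<open>H\<close>-component in one step equals
      \<open>b \<otimes> \<beta> \<otimes> inv \<beta>'\<close>, of length
      \<open>1 + h + (l - 1) * h = l * h + 1\<close>. It lies in \<open>H\<close> as well, hence in
      \<open>K\<close>.\<close>
    have "s' \<otimes> inv s = (s' \<otimes> \<beta>') \<otimes> inv \<beta>' \<otimes> inv s"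
      using carr by (simp add: m_assoc)
    also have "\<dots> = (b \<otimes> \<beta>) \<otimes> inv \<beta>' \<otimes> (s \<otimes> inv s)"
      unfolding eq using carr by (simp only: m_ac m_closed inv_closed)
    also have "\<dots> = (b \<otimes> \<beta>) \<otimes> inv \<beta>'"
      using carr by simp
    also have "\<dots> \<in> sumset G ((1 + h) + (l - 1) * h) B"
      using b s s' B by (intro quot sumset_add_memI) (simp_all add: sumset_1 del: One_nat_def)
    finally have "s' \<otimes> inv s \<in> sumset G ((1 + h) + (l - 1) * h) B" .
    moreover have "(1 + h) + (l - 1) * h = l * h + 1"
      using l by (cases l) simp_all
    ultimately have "s' \<otimes> inv s \<in> K"
      using K s s' by auto
    then have "(s' \<otimes> inv s) \<otimes> (s \<otimes> inv s0) \<in> K"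
      using s by simp
    also have "(s' \<otimes> inv s) \<otimes> (s \<otimes> inv s0) = s' \<otimes> inv s0"
      using carr by (simp add: m_assoc inv_mult_cancel)
    finally show ?case using s' by blast
  qed
  from this[of "M + M"] obtain s \<beta> where s: "s \<in> H" "\<beta> \<in> sumset G h B" "s \<otimes> \<beta> = s0 \<otimes> \<beta>0 \<otimes> t"
    and sK: "s \<otimes> inv s0 \<in> K"
    using c_end s0 by auto
  have carr: "s \<in> carrier G" "s0 \<in> carrier G" "\<beta> \<in> carrier G" "\<beta>0 \<in> carrier G" "t \<in> carrier G"
    using s s0 t S_sub by auto
  have "(s \<otimes> inv s0) \<otimes> (\<beta> \<otimes> inv \<beta>0) = (s \<otimes> \<beta>) \<otimes> (inv s0 \<otimes> inv \<beta>0)"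
    using carr by (simp only: m_ac m_closed inv_closed)
  also have "\<dots> = t \<otimes> (s0 \<otimes> inv s0) \<otimes> (\<beta>0 \<otimes> inv \<beta>0)"
    unfolding s(3) using carr by (simp only: m_ac m_closed inv_closed)
  also have "\<dots> = t" using carr by simp
  finally have t_eq: "(s \<otimes> inv s0) \<otimes> (\<beta> \<otimes> inv \<beta>0) = t" .
  then have "\<beta> \<otimes> inv \<beta>0 = inv (s \<otimes> inv s0) \<otimes> t"
    using carr inv_mult_cancel by (metis inv_closed m_closed)
  also have "\<dots> \<in> H" using s s0 t by simp
  finally have "\<beta> \<otimes> inv \<beta>0 \<in> H" .
  \<comment> \<open>The quotient of the two \<open>B\<close>-components has length
    \<open>l * h\<close>; one identity factor brings it to \<open>l * h + 1\<close>, the length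
    controlled by \<open>K\<close>.\<close>
  moreover have "\<beta> \<otimes> inv \<beta>0 \<in> sumset G (h + (l - 1) * h) B"
    using s s0 by (intro quot)
  moreover have "sumset G (h + (l - 1) * h) B \<subseteq> sumset G (l * h + 1) B"
    using l by (intro sumset_le B) (cases l; simp)
  ultimately have "\<beta> \<otimes> inv \<beta>0 \<in> K"
    using K by blast
  then show "t \<in> K"
    using sK t_eq K.m_closed by blast
qed

text \<open>Let \<open>T\<close> be the set of short elements of \<open>H\<close>. The union of its
  iterated sumsets is a subgroup containing \<open>T\<close>, so it contains \<open>H\<close> by the
  preceding lemma. Inside the finite \<open>H\<close> this union is already reached after
  \<open>card H\<close> factors.\<close>

lemma subgroup_le_sumset:
  assumes "infinite (carrier G)"
    and l: "l \<ge> 1" "\<And>x. x \<in> carrier G \<Longrightarrow> x [^] (l::nat) = \<one>"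
    and B: "B \<subseteq> carrier G" "\<one> \<in> B" "sumset G M B \<sim>\<^sub>f carrier G"
    and H: "subgroup H G" "finite H" "H <#> sumset G h B \<sim>\<^sub>f carrier G"
  shows "H \<subseteq> sumset G (card H * (l * h + 1)) B"
proof -
  interpret H: subgroup H G by (rule H)
  define T where "T = H \<inter> sumset G (l * h + 1) B"
  have "\<one> \<in> sumset G (l * h + 1) B"
    using sumset_le[OF B(1,2), of 0 "l * h + 1"] by simp
  then have T: "T \<subseteq> carrier G" "\<one> \<in> T" "T \<subseteq> H"
    by (auto simp: T_def)
  have TH: "sumset G n T \<subseteq> H" for n
    by (induction n) (use T in \<open>auto simp: set_mult_def\<close>)
  have "mono (\<lambda>n. sumset G n T)"
    by (intro monoI sumset_le T)
  moreover have "finite (range (\<lambda>n. sumset G n T))"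
    by (rule finite_subset[of _ "Pow H"]) (use TH H(2) in auto)
  \<comment> \<open>Growth that pauses once stops for good, so the sumsets increase strictly until
    they are stable, which takes at most \<open>card H\<close> steps.\<close>
  moreover have "\<forall>n. sumset G n T = sumset G (Suc n) T \<longrightarrow>
      sumset G (Suc n) T = sumset G (Suc (Suc n)) T"
  proof (intro allI impI)
    fix n assume "sumset G n T = sumset G (Suc n) T"
    then have "T <#> sumset G n T = T <#> sumset G (Suc n) T"
      by (rule arg_cong)
    then show "sumset G (Suc n) T = sumset G (Suc (Suc n)) T"
      by (simp only: sumset.simps)
  qed
  ultimately have "\<exists>N. (\<forall>n\<le>N. \<forall>m\<le>N. m < n \<longrightarrow> sumset G m T \<subset> sumset G n T) \<and>
      (\<forall>n\<ge>N. sumset G N T = sumset G n T)"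
    by (intro finite_mono_remains_stable_implies_strict_prefix)
  then have stable: "sumset G (card H) T = (\<Union>n. sumset G n T)"
    by (intro finite_mono_strict_prefix_implies_finite_fixpoint TH H(2))
  have "subgroup (\<Union>n. sumset G n T) G"
  proof (rule subgroup_if_exponent[OF _ _ _ l])
    show "(\<Union>n. sumset G n T) \<subseteq> carrier G" using TH H.subset by blast
    show "\<one> \<in> (\<Union>n. sumset G n T)" by (rule UN_I[of 0]) auto
    fix x y assume "x \<in> (\<Union>n. sumset G n T)" "y \<in> (\<Union>n. sumset G n T)"
    then show "x \<otimes> y \<in> (\<Union>n. sumset G n T)"
      using sumset_add_memI[OF T(1)] by blast
  qed auto
  moreover have "T \<subseteq> (\<Union>n. sumset G n T)"
    using sumset_1[OF T(1)] by blast
  ultimately have "H \<subseteq> (\<Union>n. sumset G n T)"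
    unfolding T_def by (intro subgroup_le_if_contains_short_sums[OF assms(1) l B H(1,3)])
  also have "\<dots> = sumset G (card H) T" by (simp only: stable)
  also have "\<dots> \<subseteq> sumset G (card H) (sumset G (l * h + 1) B)"
    by (rule sumset_mono) (simp add: T_def)
  also have "\<dots> = sumset G (card H * (l * h + 1)) B"
    by (rule sumset_mult[symmetric]) fact
  finally show ?thesis .
qed

text \<open>By commutativity the factors from \<open>H\<close> collapse into a single element of
  \<open>H\<close>; the places they leave are filled with the identity, which lies in
  \<open>B\<close>.\<close>

lemma sumset_union_subgroup:
  assumes "subgroup H G" "A \<subseteq> H \<union> B" "B \<subseteq> carrier G" "\<one> \<in> B"
  shows "sumset G h A \<subseteq> H <#> sumset G h B"
proof (induction h)
  case 0
  interpret H: subgroup H G by (rule assms)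
  have "\<one> \<otimes> \<one> \<in> H <#> {\<one>}" by (intro set_mult_memI) auto
  then show ?case by simp
next
  case (Suc h)
  interpret H: subgroup H G by (rule assms)
  show ?case
  proof
    fix x assume "x \<in> sumset G (Suc h) A"
    then obtain a y where "a \<in> A" "y \<in> sumset G h A" "x = a \<otimes> y"
      by (auto simp: set_mult_def)
    then obtain s \<beta> where *: "a \<in> H \<union> B" "s \<in> H" "\<beta> \<in> sumset G h B" "x = a \<otimes> (s \<otimes> \<beta>)"
      using Suc assms(2) by (force simp: set_mult_def)
    then have carr: "a \<in> carrier G" "s \<in> carrier G" "\<beta> \<in> carrier G"
      using assms(3) sumset_subset[OF assms(3)] by auto
    show "x \<in> H <#> sumset G (Suc h) B"
    proof (cases "a \<in> H")
      case True
      have "\<beta> \<in> sumset G (Suc h) B"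
        using * sumset_le[OF assms(3,4), of h "Suc h"] by auto
      then have "(a \<otimes> s) \<otimes> \<beta> \<in> H <#> sumset G (Suc h) B"
        using True * by (intro set_mult_memI) auto
      then show ?thesis using * carr by (simp add: m_assoc)
    next
      case False
      then have "s \<otimes> (a \<otimes> \<beta>) \<in> H <#> sumset G (Suc h) B"
        using * by (auto intro!: set_mult_memI)
      then show ?thesis using * carr by (simp add: m_lcomm)
    qed
  qed
qed

lemma almost_eq_carrier_superset:
  assumes "U \<sim>\<^sub>f carrier G" "U \<subseteq> V" "V \<subseteq> carrier G"
  shows "V \<sim>\<^sub>f carrier G"
proof -
  have "finite (carrier G - U)"
    using assms by (simp add: almost_eq_carrier_iff)
  then have "finite (carrier G - V)"
    by (rule rev_finite_subset) (use assms in auto)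
  then show ?thesis using assms by (simp add: almost_eq_carrier_iff)
qed

text \<open>After translation by \<open>inv a\<close> with \<open>a\<close> in \<open>A - F\<close>,
  the identity survives the removal, and the translate of \<open>F\<close> lies in a finite subgroup
  \<open>H\<close>. Then \<open>H\<close> costs \<open>l ^ card F * (l * h + 1)\<close> factors from
  \<open>B\<close>, and the remaining part costs \<open>h\<close>.\<close>

lemma sumset_remove_almost_eq:
  assumes "infinite (carrier G)"
    and l: "l \<ge> 1" "\<And>x. x \<in> carrier G \<Longrightarrow> x [^] (l::nat) = \<one>"
    and A: "A \<subseteq> carrier G" "sumset G h A \<sim>\<^sub>f carrier G"
    and F: "F \<subseteq> A" "finite F" "sumset G M (A - F) \<sim>\<^sub>f carrier G" "A - F \<noteq> {}"
  shows "sumset G (l ^ card F * (l * h + 1) + h) (A - F) \<sim>\<^sub>f carrier G"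
proof -
  obtain a where a: "a \<in> A - F" using F by blast
  then have ac: "a \<in> carrier G" using A by auto
  define A' where "A' = inv a <# A"
  define B where "B = inv a <# (A - F)"
  have A': "A' \<subseteq> carrier G" "sumset G h A' \<sim>\<^sub>f carrier G"
    using A ac by (simp_all add: A'_def sumset_l_coset_almost_eq_iff l_coset_subset_G)
  have AF: "A - F \<subseteq> carrier G" using A by auto
  have B: "B \<subseteq> carrier G" "sumset G M B \<sim>\<^sub>f carrier G"
    using AF F ac by (simp_all add: B_def sumset_l_coset_almost_eq_iff l_coset_subset_G)
  have B1: "\<one> \<in> B"
    unfolding B_def l_coset_eq_image by (rule image_eqI[OF _ a]) (use ac in simp)
  have "inv a <# F \<subseteq> carrier G"
    using F A ac by (intro l_coset_subset_G) auto
  moreover have fin: "finite (inv a <# F)"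
    using F by (simp add: l_coset_eq_image)
  ultimately obtain H where H: "subgroup H G" "inv a <# F \<subseteq> H" "finite H"
    "card H \<le> l ^ card (inv a <# F)"
    using exists_finite_subgroup[OF _ _ l] by blast
  interpret H: subgroup H G by (rule H)
  have cardH: "card H \<le> l ^ card F"
  proof -
    have "card (inv a <# F) \<le> card F"
      using F by (simp add: l_coset_eq_image card_image_le)
    then have "l ^ card (inv a <# F) \<le> l ^ card F"
      using l by (intro power_increasing)
    then show ?thesis using H by linarith
  qed
  have S_sub: "sumset G n B \<subseteq> carrier G" for n using B by (intro sumset_subset)
  have "A' \<subseteq> H \<union> B"
    using H(2) by (auto simp: A'_def B_def l_coset_eq_image)
  then have sub: "sumset G h A' \<subseteq> H <#> sumset G h B"
    by (rule sumset_union_subgroup[OF H(1) _ B(1) B1])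
  have HB: "H <#> sumset G h B \<sim>\<^sub>f carrier G"
    by (rule almost_eq_carrier_superset[OF A'(2) sub]) (rule set_mult_closed[OF H.subset S_sub])
  let ?N = "l ^ card F * (l * h + 1)"
  have "H \<subseteq> sumset G (card H * (l * h + 1)) B"
    by (rule subgroup_le_sumset[OF assms(1) l B(1) B1 B(2) H(1,3) HB])
  also have "\<dots> \<subseteq> sumset G ?N B"
    using cardH by (intro sumset_le B B1 mult_le_mono1)
  finally have "H <#> sumset G h B \<subseteq> sumset G (?N + h) B"
    unfolding sumset_add[OF B(1)] by (intro mono_set_mult) auto
  then have "sumset G (?N + h) B \<sim>\<^sub>f carrier G"
    by (rule almost_eq_carrier_superset[OF HB _ S_sub])
  then show ?thesis
    using AF ac by (simp add: B_def sumset_l_coset_almost_eq_iff)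
qed

section \<open>Removing one element\<close>

text \<open>Appending \<open>l * q\<close> copies of one \<open>b\<close> in \<open>B\<close>
  multiplies by the identity. This replaces padding by the identity, which need not lie in
  \<open>B\<close> here.\<close>

lemma sumset_pad_exponent:
  assumes "B \<subseteq> carrier G" "B \<noteq> {}" "\<And>x. x \<in> carrier G \<Longrightarrow> x [^] (l::nat) = \<one>"
    and "x \<in> sumset G n B"
  shows "x \<in> sumset G (n + l * q) B"
proof -
  obtain b where b: "b \<in> B" using assms by blast
  then have bc: "b \<in> carrier G" using assms by auto
  have "b [^] (l * q) \<in> sumset G (l * q * 1) B"
    using b assms(1) by (intro sumset_pow) (simp_all only: sumset_1)
  moreover have "b [^] (l * q) = \<one>"
    using bc assms(3) by (simp add: nat_pow_pow[symmetric])
  ultimately have "x \<otimes> \<one> \<in> sumset G (n + l * q) B"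
    using assms(1,4) by (intro sumset_add_memI) simp_all
  then show ?thesis
    using assms(4) sumset_subset[OF assms(1)] by (metis r_one subsetD)
qed

text \<open>Otherwise the length modulo \<open>p\<close> would be well defined for lengths up to
  \<open>h + 1\<close> and would grow by 1 at each step of a walk. A closed walk whose number of
  steps is not divisible by \<open>p\<close> contradicts this.\<close>

lemma exists_two_short_lengths:
  assumes "infinite (carrier G)" and B: "B \<subseteq> carrier G" "sumset G M B \<sim>\<^sub>f carrier G"
    and U: "(\<Union>i\<le>h. sumset G i B) \<sim>\<^sub>f carrier G"
    and p: "p > (1::nat)"
  shows "\<exists>z a b. a \<le> h + 1 \<and> b \<le> h + 1 \<and> \<not> [a = b] (mod p) \<and>
    z \<in> sumset G a B \<and> z \<in> sumset G b B"
proof (rule ccontr)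
  assume contra: "\<not> ?thesis"
  have uniq: "[a = b] (mod p)" if "z \<in> sumset G a B" "z \<in> sumset G b B" "a \<le> h + 1" "b \<le> h + 1" for z a b
    using contra that by blast
  have full: "sumset G (M + M) B = carrier G"
    by (rule sumset_double_eq_carrier) fact+
  \<comment> \<open>The identity is a product of \<open>M + M\<close> and also of
    \<open>M + M + 1\<close> elements of \<open>B\<close>. Of two consecutive numbers one is not
    divisible by \<open>p\<close>, and it serves as the number of steps of the closed walk.\<close>
  have "\<one> \<in> sumset G (Suc (M + M)) B"
  proof -
    have "B \<noteq> {}"
    proof
      assume "B = {}"
      then have "sumset G (M + M) B \<subseteq> {\<one>}"
        by (cases M) (auto simp: set_mult_def)
      then show False
        using full assms(1) finite_subset by fastforce
    qed
    then obtain b where b: "b \<in> B" by blast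
    then have "b \<otimes> inv b \<in> B <#> sumset G (M + M) B"
      using B full by (intro set_mult_memI) auto
    then show ?thesis using b B by auto
  qed
  moreover have "\<one> \<in> sumset G (M + M) B" using full by simp
  moreover have "\<not> p dvd M + M \<or> \<not> p dvd Suc (M + M)"
    using p by (metis dvd_add_right_iff nat_dvd_1_iff_1 not_less_iff_gr_or_eq plus_1_eq_Suc add.commute)
  ultimately obtain n where n: "\<one> \<in> sumset G n B" "\<not> p dvd n" by blast
  have sub: "(\<Union>i\<le>h. sumset G i B) \<subseteq> carrier G"
    using sumset_subset[OF B(1)] by auto
  then have "finite (carrier G - (\<Union>i\<le>h. sumset G i B))"
    using U by (simp only: almost_eq_carrier_iff)
  from sumset_path_avoiding[OF assms(1) this B(1) n(1)] obtain c
    where c_end: "c n = c 0 \<otimes> \<one>"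
    and c_mem: "\<And>i. i \<le> n \<Longrightarrow> c i \<in> carrier G - (carrier G - (\<Union>i\<le>h. sumset G i B))"
    and c_step: "\<And>i. i < n \<Longrightarrow> \<exists>b\<in>B. c (Suc i) = b \<otimes> c i"
    by metis
  have c_length: "\<exists>i\<le>h. c j \<in> sumset G i B" if "j \<le> n" for j
    using c_mem[OF that] by auto
  obtain i0 where i0: "i0 \<le> h" "c 0 \<in> sumset G i0 B"
    using c_length[of 0] by auto
  have "\<exists>i\<le>h. c j \<in> sumset G i B \<and> [i = i0 + j] (mod p)" if "j \<le> n" for j
    using that
  proof (induction j)
    case 0
    then show ?case using i0 by (intro exI[of _ i0]) simp
  next
    case (Suc j)
    then obtain i where i: "i \<le> h" "c j \<in> sumset G i B" "[i = i0 + j] (mod p)"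
      by auto
    obtain b where "b \<in> B" "c (Suc j) = b \<otimes> c j"
      using c_step[of j] Suc.prems by auto
    then have 1: "c (Suc j) \<in> sumset G (Suc i) B"
      using i by (auto intro: set_mult_memI)
    obtain i' where i': "i' \<le> h" "c (Suc j) \<in> sumset G i' B"
      using c_length[OF Suc.prems] by blast
    \<comment> \<open>Here uniqueness is applied to the length \<open>Suc i\<close>, which may be
      \<open>h + 1\<close>; this is why lengths up to \<open>h + 1\<close> are allowed.\<close>
    have "[i' = Suc i] (mod p)"
      using i i' 1 by (intro uniq) auto
    also have "[Suc i = Suc (i0 + j)] (mod p)"
      using i(3) cong_add_rcancel_nat[of i 1 "i0 + j" p] by simp
    finally show ?case using i' by (intro exI[of _ i']) simp
  qed
  from this[of n] obtain i where i: "i \<le> h" "c n \<in> sumset G i B" "[i = i0 + n] (mod p)"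
    by auto
  have "c n = c 0" using c_end c_mem[of 0] by simp
  then have "[i = i0] (mod p)"
    using i i0 by (intro uniq[of "c 0"]) auto
  then have "[i0 + n = i0 + 0] (mod p)"
    using i(3) by (metis add_0_right cong_sym cong_trans)
  then have "[n = 0] (mod p)"
    by (simp only: cong_add_lcancel_nat)
  then show False using n(2) by (simp add: cong_0_iff)
qed

text \<open>The expression is affine in \<open>j\<close> with slope \<open>a - b\<close>, a unit
  modulo \<open>l\<close>, so some residue \<open>j\<close> in \<open>0..l - 1\<close> solves the
  congruence. Integers are used since \<open>a - b\<close> may be negative.\<close>

lemma exists_weights_cong:
  assumes l: "l \<ge> (1::nat)" and cop: "coprime (int a - int b) (int l)"
  shows "\<exists>j\<le>l - 1. [int (i + j * a + (l - 1 - j) * b) = int N] (mod int l)"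
proof -
  obtain u where u: "[(int a - int b) * u = 1] (mod int l)"
    using cong_solve_coprime_int[OF cop] by blast
  \<comment> \<open>\<open>v\<close> is the value that \<open>(a - b) * j\<close> must take modulo
    \<open>l\<close>, and \<open>u\<close> inverts \<open>a - b\<close>.\<close>
  define v where "v = int N - int i - int (l - 1) * int b"
  define j where "j = nat ((u * v) mod int l)"
  have j: "int j = (u * v) mod int l" using l by (simp add: j_def)
  then have "int j < int l" using l by simp
  then have jl: "j \<le> l - 1" by linarith
  have "int (i + j * a + (l - 1 - j) * b) = int i + int (l - 1) * int b + (int a - int b) * int j"
    unfolding of_nat_add of_nat_mult of_nat_diff[OF jl] by (simp only: algebra_simps)
  also have "[\<dots> = int i + int (l - 1) * int b + (int a - int b) * (u * v)] (mod int l)"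
    unfolding j by (intro cong_add cong_mult cong_refl) (simp add: cong_def)
  also have "[int i + int (l - 1) * int b + (int a - int b) * (u * v)
      = int i + int (l - 1) * int b + 1 * v] (mod int l)"
    unfolding mult.assoc[symmetric] by (intro cong_add cong_mult cong_refl u)
  also have "int i + int (l - 1) * int b + 1 * v = int N"
    by (simp add: v_def)
  finally show ?thesis using jl by blast
qed

text \<open>In \<open>z [^] (l - 1)\<close>, write \<open>j\<close> factors with length
  \<open>a\<close> and the others with length \<open>b\<close>. A suitable \<open>j\<close> gives
  \<open>z [^] (l - 1) \<otimes> y\<close> a length congruent to the target for every
  \<open>y\<close> in the union, so a translate of a cofinite set lies in one sumset.\<close>

lemma sumset_almost_eq_if_two_lengths:
  assumes l: "l \<ge> 1" "\<And>x. x \<in> carrier G \<Longrightarrow> x [^] (l::nat) = \<one>"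
    and B: "B \<subseteq> carrier G" "B \<noteq> {}"
    and U: "(\<Union>i\<le>h. sumset G i B) \<sim>\<^sub>f carrier G"
    and z: "z \<in> sumset G a B" "z \<in> sumset G b B" "a \<le> n" "b \<le> n"
    and cop: "coprime (int a - int b) (int l)"
  shows "sumset G (h + (l - 1) * n) B \<sim>\<^sub>f carrier G"
proof -
  let ?U = "\<Union>i\<le>h. sumset G i B" and ?N = "h + (l - 1) * n"
  have zc: "z \<in> carrier G" using z sumset_subset[OF B(1)] by blast
  have sub: "?U \<subseteq> carrier G" using sumset_subset[OF B(1)] by auto
  have "z [^] (l - 1) \<otimes> y \<in> sumset G ?N B" if i: "i \<le> h" "y \<in> sumset G i B" for i y
  proof -
    obtain j where j: "j \<le> l - 1" "[int (i + j * a + (l - 1 - j) * b) = int ?N] (mod int l)"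
      using exists_weights_cong[OF l(1) cop] by blast
    have yc: "y \<in> carrier G" using i sumset_subset[OF B(1)] by blast
    let ?m = "i + j * a + (l - 1 - j) * b"
    have "j * a + (l - 1 - j) * b \<le> j * n + (l - 1 - j) * n"
      using z by (intro add_mono mult_le_mono2)
    \<comment> \<open>Padding only lengthens, so the length \<open>?m\<close> must not exceed the
      target \<open>?N\<close>; the choice of \<open>?N\<close> covers the worst case
      \<open>i = h\<close> with all factors of length \<open>n\<close>.\<close>
    also have "\<dots> = (l - 1) * n"
      unfolding add_mult_distrib[symmetric] le_add_diff_inverse[OF j(1)] by simp
    finally have le: "?m \<le> ?N" using i by simp
    have "[?m = ?N] (mod l)" using j(2) by (simp only: cong_int_iff)
    then obtain q where q: "?N = ?m + l * q"
      using le by (metis cong_le_nat cong_sym mult.commute add.commute)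
    have "y \<otimes> z [^] j \<otimes> z [^] (l - 1 - j) \<in> sumset G ?m B"
      using i z B by (intro sumset_add_memI sumset_pow)
    also have "y \<otimes> z [^] j \<otimes> z [^] (l - 1 - j) = y \<otimes> z [^] (j + (l - 1 - j))"
      using zc yc by (simp only: m_assoc nat_pow_mult nat_pow_closed)
    also have "\<dots> = z [^] (l - 1) \<otimes> y"
      unfolding le_add_diff_inverse[OF j(1)] using zc yc by (intro m_comm) auto
    finally have zy: "z [^] (l - 1) \<otimes> y \<in> sumset G ?m B" .
    show ?thesis
      unfolding q by (rule sumset_pad_exponent[OF B l(2) zy])
  qed
  then have le: "z [^] (l - 1) <# ?U \<subseteq> sumset G ?N B"
    by (auto simp: l_coset_eq_image)
  have "z [^] (l - 1) <# ?U \<sim>\<^sub>f carrier G"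
    by (rule almost_eq_l_coset[OF sub _ U]) (use zc in simp)
  then show ?thesis
    by (rule almost_eq_carrier_superset[OF _ le sumset_subset[OF B(1)]])
qed

text \<open>Identity factors are dropped, so an \<open>h\<close>-fold product becomes a shorter
  product over \<open>B\<close>.\<close>

lemma sumset_insert_one:
  assumes "B \<subseteq> carrier G" "A \<subseteq> insert \<one> B"
  shows "sumset G h A \<subseteq> (\<Union>i\<le>h. sumset G i B)"
proof (induction h)
  case 0
  then show ?case by simp
next
  case (Suc h)
  show ?case
  proof
    fix x assume "x \<in> sumset G (Suc h) A"
    then obtain a y where "a \<in> A" "y \<in> sumset G h A" "x = a \<otimes> y"
      by (auto simp: set_mult_def)
    then obtain i where *: "a \<in> insert \<one> B" "i \<le> h" "y \<in> sumset G i B" "x = a \<otimes> y"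
      using Suc assms(2) by blast
    show "x \<in> (\<Union>i\<le>Suc h. sumset G i B)"
    proof (cases "a = \<one>")
      case True
      have "y \<in> carrier G" using *(3) sumset_subset[OF assms(1)] by blast
      then show ?thesis using True * by (intro UN_I[of i]) auto
    next
      case False
      then show ?thesis
        using * by (intro UN_I[of "Suc i"]) (auto intro: set_mult_memI)
    qed
  qed
qed

text \<open>Here the translation moves the removed \<open>f\<close> itself to the identity, so that
  losing it only means losing control of the length. Two lengths of one \<open>z\<close> up to
  \<open>h + 1\<close> restore that control.\<close>

lemma sumset_remove_one_almost_eq:
  assumes "infinite (carrier G)"
    and l: "primepow l" "\<And>x. x \<in> carrier G \<Longrightarrow> x [^] (l::nat) = \<one>"
    and A: "A \<subseteq> carrier G" "sumset G h A \<sim>\<^sub>f carrier G"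
    and f: "f \<in> A" "sumset G M (A - {f}) \<sim>\<^sub>f carrier G" "A - {f} \<noteq> {}"
  shows "sumset G (h + (l - 1) * (h + 1)) (A - {f}) \<sim>\<^sub>f carrier G"
proof -
  obtain p r :: nat where p: "Factorial_Ring.prime p" "r > 0" "l = p ^ r"
    using l(1) by (auto simp: primepow_def)
  have l1: "l \<ge> 1" using primepow_gt_Suc_0[OF l(1)] by simp
  have fc: "f \<in> carrier G" using f A by auto
  define A' where "A' = inv f <# A"
  define B where "B = inv f <# (A - {f})"
  have A': "A' \<subseteq> carrier G" "sumset G h A' \<sim>\<^sub>f carrier G"
    using A fc by (simp_all add: A'_def sumset_l_coset_almost_eq_iff l_coset_subset_G)
  have Af: "A - {f} \<subseteq> carrier G" using A by auto
  have B: "B \<subseteq> carrier G" "sumset G M B \<sim>\<^sub>f carrier G"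
    using Af f fc by (simp_all add: B_def sumset_l_coset_almost_eq_iff l_coset_subset_G)
  have B_ne: "B \<noteq> {}" using f by (auto simp: B_def l_coset_eq_image)
  have "A' \<subseteq> insert \<one> B"
    using fc by (auto simp: A'_def B_def l_coset_eq_image)
  then have "sumset G h A' \<subseteq> (\<Union>i\<le>h. sumset G i B)"
    by (rule sumset_insert_one[OF B(1)])
  then have U: "(\<Union>i\<le>h. sumset G i B) \<sim>\<^sub>f carrier G"
    by (rule almost_eq_carrier_superset[OF A'(2)]) (use sumset_subset[OF B(1)] in auto)
  obtain z a b where ab: "a \<le> h + 1" "b \<le> h + 1" "\<not> [a = b] (mod p)"
    and z: "z \<in> sumset G a B" "z \<in> sumset G b B"
    using exists_two_short_lengths[OF assms(1) B U prime_gt_1_nat[OF p(1)]] by blast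
  \<comment> \<open>Since \<open>l\<close> is a power of \<open>p\<close>, a difference not
    divisible by \<open>p\<close> is a unit modulo \<open>l\<close>; this is where the prime power
    assumption enters.\<close>
  have "\<not> int p dvd int a - int b"
    using ab(3) by (simp only: cong_iff_dvd_diff[symmetric] cong_int_iff not_False_eq_True)
  then have "coprime (int p) (int a - int b)"
    using p(1) by (intro prime_imp_coprime) simp_all
  then have cop: "coprime (int a - int b) (int l)"
    using p by (simp add: coprime_commute)
  have "sumset G (h + (l - 1) * (h + 1)) B \<sim>\<^sub>f carrier G"
    by (rule sumset_almost_eq_if_two_lengths[OF l1 l(2) B(1) B_ne U z ab(1,2) cop])
  then show ?thesis
    using Af fc by (simp add: B_def sumset_l_coset_almost_eq_iff del: sumset.simps)
qed

end

section \<open>Bounds for the order\<close>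

lemma max_basis_ord_le:
  assumes "\<And>A F. A \<subseteq> carrier G \<Longrightarrow> sumset G h A \<sim>\<^sub>f carrier G \<Longrightarrow> regular_subset G A F \<Longrightarrow>
      card F = k \<Longrightarrow> \<exists>n. 1 \<le> n \<and> n \<le> N \<and> sumset G n (A - F) \<sim>\<^sub>f carrier G"
  shows "max_basis_ord G h k \<le> enat N"
  unfolding max_basis_ord_def
proof (rule SUP_least, clarify)
  fix A F assume "A \<subseteq> carrier G" "sumset G h A \<sim>\<^sub>f carrier G" "regular_subset G A F" "k = card F"
  then obtain n where n: "1 \<le> n" "n \<le> N" "sumset G n (A - F) \<sim>\<^sub>f carrier G"
    using assms by blast
  then have "basis_ord G (A - F) \<le> enat n"
    unfolding basis_ord_def by (intro INF_lower) auto
  also have "\<dots> \<le> enat N" using n by simp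
  finally show "basis_ord G (A - F) \<le> enat N" .
qed

lemma additive_basis_nonempty:
  assumes "additive_basis G B" "infinite (carrier G)"
  shows "B \<noteq> {}"
proof
  assume "B = {}"
  with assms(1) obtain M where "M \<ge> 1" "sumset G M {} \<sim>\<^sub>f carrier G"
    by (auto simp: additive_basis_def)
  then have "{} \<sim>\<^sub>f carrier G"
    by (cases M) (auto simp: set_mult_def)
  then show False using assms(2) by (simp add: almost_eq_def)
qed

text \<open>Exponent 1 would make the group trivial. The two estimates below rely on
  \<open>l \<ge> 2\<close>.\<close>

lemma has_exponent_ge_2:
  assumes "group G" "has_exponent G l" "infinite (carrier G)"
  shows "l \<ge> 2"
proof (rule ccontr)
  interpret group G by fact
  assume "\<not> l \<ge> 2"
  then have "l = 1" using assms(2) by (auto simp: has_exponent_def)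
  then have "carrier G \<subseteq> {\<one>\<^bsub>G\<^esub>}"
    using assms(2) by (auto simp: has_exponent_def)
  then show False using assms(3) finite_subset by blast
qed

text \<open>With \<open>m = l ^ k\<close>, after adding \<open>m\<close> to both sides, it suffices
  that \<open>l \<le> m\<close> and \<open>2 \<le> m\<close>.\<close>

lemma removal_bound_le:
  assumes "l \<ge> (2::nat)" "k \<ge> 1"
  shows "l ^ k * (l * h + 1) + h \<le> l ^ (2 * k) * (h + 1) - l ^ k + h"
proof -
  define m where "m = l ^ k"
  have "l ^ 1 \<le> l ^ k" using assms by (intro power_increasing) auto
  then have m: "l \<le> m" "2 \<le> m" using assms by (auto simp: m_def)
  have "m * (l * h) + 2 * m \<le> m * (m * h) + m * m"
    using m by (intro add_mono mult_le_mono) auto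
  then have "m * (l * h + 1) + m \<le> m * m * (h + 1)"
    by (simp only: algebra_simps mult_2 add_0_right mult_1_right)
  moreover have "l ^ (2 * k) = m * m"
    by (simp add: m_def mult_2 power_add)
  ultimately show ?thesis unfolding m_def[symmetric] by simp
qed

text \<open>For \<open>l = n + 1\<close> the two sides are \<open>l * h + n\<close> and
  \<open>l * h + n * l\<close>.\<close>

lemma removal_one_bound_le:
  assumes "l \<ge> (2::nat)"
  shows "h + (l - 1) * (h + 1) \<le> l * h + l ^ 2 - l"
proof -
  obtain n where n: "l = Suc n" "n \<ge> 1" using assms by (cases l) auto
  have "l ^ 2 - l = n * l" by (simp add: n(1) power2_eq_square)
  moreover have "l \<le> l ^ 2" by (simp add: power2_eq_square)
  ultimately have "l * h + l ^ 2 - l = l * h + n * l" by simp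
  moreover have "h + (l - 1) * (h + 1) = l * h + n" by (simp add: n(1))
  ultimately show ?thesis using n by simp
qed

(* The subtractions on nat never truncate, since l \<ge> 1. *)
theorem theorem6:
  fixes G :: "('a, 'b) monoid_scheme" and l h k :: nat
  assumes "comm_group G"
    and "infinite (carrier G)"
    and "has_exponent G l"
    and "h \<ge> 1"
    and "k \<ge> 1"
  shows "max_basis_ord G h k \<le> enat (l ^ (2 * k) * (h + 1) - l ^ k + h) \<and>
    (primepow l \<longrightarrow> max_basis_ord G h 1 \<le> enat (l * h + l ^ 2 - l))"
proof (intro conjI impI)
  interpret comm_group G by fact
  have l: "l \<ge> 1" "\<And>x. x \<in> carrier G \<Longrightarrow> x [^]\<^bsub>G\<^esub> l = \<one>\<^bsub>G\<^esub>"
    using assms(3) by (auto simp: has_exponent_def)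
  have l2: "l \<ge> 2" by (rule has_exponent_ge_2[OF is_group assms(3,2)])
  have basis: "\<exists>M. sumset G M B \<sim>\<^sub>f carrier G" if "additive_basis G B" for B
    using that by (auto simp: additive_basis_def)
  show "max_basis_ord G h k \<le> enat (l ^ (2 * k) * (h + 1) - l ^ k + h)"
  proof (rule max_basis_ord_le)
    fix A F assume A: "A \<subseteq> carrier G" "sumset G h A \<sim>\<^sub>f carrier G"
      and F: "regular_subset G A F" "card F = k"
    have reg: "F \<subseteq> A" "additive_basis G (A - F)"
      using F by (auto simp: regular_subset_def)
    have "finite F" using F assms(5) by (intro card_ge_0_finite) simp
    moreover obtain M where "sumset G M (A - F) \<sim>\<^sub>f carrier G"
      using basis[OF reg(2)] by blast
    ultimately have "sumset G (l ^ k * (l * h + 1) + h) (A - F) \<sim>\<^sub>f carrier G"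
      using sumset_remove_almost_eq[OF assms(2) l A reg(1) _ _ additive_basis_nonempty[OF reg(2) assms(2)]] F(2)
      by blast
    then show "\<exists>n. 1 \<le> n \<and> n \<le> l ^ (2 * k) * (h + 1) - l ^ k + h \<and> sumset G n (A - F) \<sim>\<^sub>f carrier G"
      using removal_bound_le[OF l2 assms(5)] assms(4)
      by (intro exI[of _ "l ^ k * (l * h + 1) + h"] conjI) auto
  qed
  assume pp: "primepow l"
  show "max_basis_ord G h 1 \<le> enat (l * h + l ^ 2 - l)"
  proof (rule max_basis_ord_le)
    fix A F assume A: "A \<subseteq> carrier G" "sumset G h A \<sim>\<^sub>f carrier G"
      and F: "regular_subset G A F" "card F = 1"
    obtain f where f: "F = {f}" using F(2) by (rule card_1_singletonE)
    have reg: "f \<in> A" "additive_basis G (A - {f})"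
      using F f by (auto simp: regular_subset_def)
    obtain M where "sumset G M (A - {f}) \<sim>\<^sub>f carrier G"
      using basis[OF reg(2)] by blast
    then have "sumset G (h + (l - 1) * (h + 1)) (A - {f}) \<sim>\<^sub>f carrier G"
      using sumset_remove_one_almost_eq[OF assms(2) pp l(2) A reg(1) _ additive_basis_nonempty[OF reg(2) assms(2)]]
      by blast
    then show "\<exists>n. 1 \<le> n \<and> n \<le> l * h + l ^ 2 - l \<and> sumset G n (A - F) \<sim>\<^sub>f carrier G"
      unfolding f using removal_one_bound_le[OF l2] assms(4)
      by (intro exI[of _ "h + (l - 1) * (h + 1)"] conjI) auto
  qed
qed

end
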